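(* Let $G=(V,E)$ be a directed graph in which every node has at least one out-neighbor, with $n$ nodes, let $\alpha\in(0,1)$, let $v\in V$ be an arbitrary target node, and let $\epsilon>0$ with $\alpha\epsilon<1$. If the priority queue algorithm (described in the context) is run with teleport probability $\alpha$, target node $v$ and additive error $\epsilon$, it takes time $$O\left(\frac{D_v(\alpha\epsilon)}{\alpha}\log\left(\frac{1}{\epsilon\alpha}\right)\right),$$ where $D_v(x)=\sum_{u\in V:\ \pi(u,v)>x}\left(|\mathrm{in}(u)|+\log n\right)$.
   Context: For $u\in V$ let $\mathrm{out}(u)=\{w:(u,w)\in E\}$ and $\mathrm{in}(u)=\{w:(w,u)\in E\}$. (Dead-end nodes are handled by adding an artificial sink with a self-loop and an edge from each dead end to the sink.) Personalized PageRank $\pi(u,v)$ is the expected fraction of time spent at $v$ by the random walk that starts at $u$ and at each step halts with probability $\alpha$ and otherwise moves to a uniformly random out-neighbor of the current node. The priority queue algorithm maintains for each node $u$ a score $s(u)$ and a priority $p(u)$, both initially $0$ except $s(v)=p(v)=\alpha$, with the nodes in a max-priority queue keyed by $p$. While the maximum priority exceeds $\alpha\epsilon$, it pops a node $w$ of maximum priority, lets $\Delta=p(w)$, sets $p(w)=0$, and for each $u\in\mathrm{in}(w)$ increases both $s(u)$ and $p(u)$ by $(1-\alpha)\Delta/|\mathrm{out}(u)|$; it then outputs $s$. Running time is measured with a priority queue in which popping the maximum costs $O(\log n)$ and increasing a priority costs $O(1)$ (amortized), so popping and propagating $w$ costs $O(|\mathrm{in}(w)|+\log n)$.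
   Formalization: The implied constant is uniform over all graphs, targets, α and ε with αε ≤ x₀, for each fixed x₀ < 1; one constant for all αε < 1 is impossible (one node with a self-loop, α and ε tending to 1: one pop occurs while the bound tends to 0). *)

theory Defs
  imports "HOL-Probability.Probability"
begin

definition out_nbrs :: "('a \<times> 'a) set \<Rightarrow> 'a \<Rightarrow> 'a set" where
  "out_nbrs E u = {w. (u, w) \<in> E}"

definition in_nbrs :: "('a \<times> 'a) set \<Rightarrow> 'a \<Rightarrow> 'a set" where
  "in_nbrs E u = {w. (w, u) \<in> E}"

text \<open>Self-loops are allowed, parallel edges are not.\<close>

definition digraph_no_dead_ends :: "'a set \<Rightarrow> ('a \<times> 'a) set \<Rightarrow> bool" where
  "digraph_no_dead_ends V E \<longleftrightarrow>
     finite V \<and> E \<subseteq> V \<times> V \<and> (\<forall>u\<in>V. out_nbrs E u \<noteq> {})"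

primrec walk :: "('a \<times> 'a) set \<Rightarrow> nat \<Rightarrow> 'a \<Rightarrow> 'a list pmf" where
  "walk E 0 u = return_pmf [u]"
| "walk E (Suc k) u =
     do {w \<leftarrow> pmf_of_set (out_nbrs E u); map_pmf ((#) u) (walk E k w)}"

text \<open>
  The trajectory of the walk that halts with probability \<open>\<alpha>\<close> at each step: the number of moves
  made before halting is geometrically distributed. Lemma \<open>halting_walk_unfold\<close> is the
  step-by-step description.
\<close>

definition halting_walk :: "('a \<times> 'a) set \<Rightarrow> real \<Rightarrow> 'a \<Rightarrow> 'a list pmf" where
  "halting_walk E \<alpha> u = do {k \<leftarrow> geometric_pmf \<alpha>; walk E k u}"

lemma halting_walk_unfold:
  assumes "0 < \<alpha>" "\<alpha> \<le> 1"
  shows "halting_walk E \<alpha> u =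
           do {halt \<leftarrow> bernoulli_pmf \<alpha>;
               if halt then return_pmf [u]
               else do {w \<leftarrow> pmf_of_set (out_nbrs E u); map_pmf ((#) u) (halting_walk E \<alpha> w)}}"
proof -
  have "halting_walk E \<alpha> u =
          do {b \<leftarrow> bernoulli_pmf \<alpha>;
              k \<leftarrow> (if b then return_pmf 0 else map_pmf Suc (geometric_pmf \<alpha>));
              walk E k u}"
    unfolding halting_walk_def
    by (subst geometric_bind_pmf_unfold) (use assms in \<open>auto simp: bind_assoc_pmf\<close>)
  also have "\<dots> =
          do {halt \<leftarrow> bernoulli_pmf \<alpha>;
              if halt then return_pmf [u]
              else do {w \<leftarrow> pmf_of_set (out_nbrs E u); map_pmf ((#) u) (halting_walk E \<alpha> w)}}"
  proof (intro bind_pmf_cong refl, goal_cases)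
    case (1 b)
    have "do {k \<leftarrow> map_pmf Suc (geometric_pmf \<alpha>); walk E k u} =
            do {k \<leftarrow> geometric_pmf \<alpha>; w \<leftarrow> pmf_of_set (out_nbrs E u);
                map_pmf ((#) u) (walk E k w)}"
      by (simp add: bind_map_pmf)
    also have "\<dots> = do {w \<leftarrow> pmf_of_set (out_nbrs E u); k \<leftarrow> geometric_pmf \<alpha>;
                map_pmf ((#) u) (walk E k w)}"
      by (rule bind_commute_pmf)
    finally show ?case
      by (simp add: halting_walk_def map_bind_pmf bind_return_pmf)
  qed
  finally show ?thesis .
qed

text \<open>
  Personalized PageRank: the expected time spent at \<open>v\<close> as a fraction of the expected total time.
\<close>

definition ppr :: "('a \<times> 'a) set \<Rightarrow> real \<Rightarrow> 'a \<Rightarrow> 'a \<Rightarrow> real" where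
  "ppr E \<alpha> u v =
     measure_pmf.expectation (halting_walk E \<alpha> u) (\<lambda>xs. real (count_list xs v)) /
     measure_pmf.expectation (halting_walk E \<alpha> u) (\<lambda>xs. real (length xs))"

definition D_target :: "'a set \<Rightarrow> ('a \<times> 'a) set \<Rightarrow> real \<Rightarrow> 'a \<Rightarrow> real \<Rightarrow> real" where
  "D_target V E \<alpha> v x =
     (\<Sum>u\<in>{u\<in>V. ppr E \<alpha> u v > x}. real (card (in_nbrs E u)) + ln (real (card V)))"

text \<open>
  A state of the algorithm is the pair of the score function and the priority function. Since ties
  between nodes of maximum priority are broken arbitrarily, one iteration of the loop is a relation.
\<close>

type_synonym 'a pq_state = "('a \<Rightarrow> real) \<times> ('a \<Rightarrow> real)"

definition pq_init :: "real \<Rightarrow> 'a \<Rightarrow> 'a pq_state" where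
  "pq_init \<alpha> v = ((\<lambda>u. if u = v then \<alpha> else 0), (\<lambda>u. if u = v then \<alpha> else 0))"

text \<open>
  The priority of the popped node \<open>w\<close> is reset before the propagation, so that a self-loop at \<open>w\<close>
  gives \<open>w\<close> a positive priority again.
\<close>

definition pq_propagate ::
  "('a \<times> 'a) set \<Rightarrow> real \<Rightarrow> 'a \<Rightarrow> 'a pq_state \<Rightarrow> 'a pq_state" where
  "pq_propagate E \<alpha> w = (\<lambda>(s, p).
     let \<Delta> = p w;
         inc = (\<lambda>u. if u \<in> in_nbrs E w then (1 - \<alpha>) * \<Delta> / real (card (out_nbrs E u)) else 0)
     in ((\<lambda>u. s u + inc u), (\<lambda>u. (p(w := 0)) u + inc u)))"

definition pq_step ::
  "'a set \<Rightarrow> ('a \<times> 'a) set \<Rightarrow> real \<Rightarrow> real \<Rightarrow> 'a pq_state \<Rightarrow> 'a \<Rightarrow> 'a pq_state \<Rightarrow> bool" where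
  "pq_step V E \<alpha> \<epsilon> \<sigma> w \<sigma>' \<longleftrightarrow>
     w \<in> V \<and> (\<forall>u\<in>V. snd \<sigma> u \<le> snd \<sigma> w) \<and> snd \<sigma> w > \<alpha> * \<epsilon> \<and> \<sigma>' = pq_propagate E \<alpha> w \<sigma>"

text \<open>\<open>pq_exec V E \<alpha> \<epsilon> \<sigma> ws \<sigma>'\<close>: a complete execution of the loop from \<open>\<sigma>\<close> ends in \<open>\<sigma>'\<close> after
  popping the nodes \<open>ws\<close> in this order.\<close>

inductive pq_exec ::
  "'a set \<Rightarrow> ('a \<times> 'a) set \<Rightarrow> real \<Rightarrow> real \<Rightarrow> 'a pq_state \<Rightarrow> 'a list \<Rightarrow> 'a pq_state \<Rightarrow> bool"
  for V :: "'a set" and E :: "('a \<times> 'a) set" and \<alpha> \<epsilon> :: real where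
  halt: "\<forall>u\<in>V. snd \<sigma> u \<le> \<alpha> * \<epsilon> \<Longrightarrow> pq_exec V E \<alpha> \<epsilon> \<sigma> [] \<sigma>"
| step: "pq_step V E \<alpha> \<epsilon> \<sigma> w \<sigma>' \<Longrightarrow> pq_exec V E \<alpha> \<epsilon> \<sigma>' ws \<sigma>'' \<Longrightarrow>
           pq_exec V E \<alpha> \<epsilon> \<sigma> (w # ws) \<sigma>''"

definition pq_diverges ::
  "'a set \<Rightarrow> ('a \<times> 'a) set \<Rightarrow> real \<Rightarrow> real \<Rightarrow> 'a pq_state \<Rightarrow> bool" where
  "pq_diverges V E \<alpha> \<epsilon> \<sigma> \<longleftrightarrow>
     (\<exists>\<tau> w. \<tau> 0 = \<sigma> \<and> (\<forall>i::nat. pq_step V E \<alpha> \<epsilon> (\<tau> i) (w i) (\<tau> (Suc i))))"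

text \<open>
  Each pop costs \<open>c_pop * ln n\<close> and each increase of a priority costs \<open>c_inc\<close>; these are the
  implied constants of the (amortized) bounds of the priority queue.
\<close>

definition pq_time ::
  "'a set \<Rightarrow> ('a \<times> 'a) set \<Rightarrow> real \<Rightarrow> real \<Rightarrow> 'a list \<Rightarrow> real" where
  "pq_time V E c_pop c_inc ws =
     (\<Sum>w\<leftarrow>ws. c_pop * ln (real (card V)) + c_inc * real (card (in_nbrs E w)))"

end

theory Submission
  imports Defs
begin

text \<open>
  Let \<open>P\<close> be the transition operator of the walk and let \<open>R u\<close> be the mass still to be popped at
  \<open>u\<close>, that is, \<open>\<pi>(u, v)\<close> minus the mass popped at \<open>u\<close> so far. Throughout the run
  \<open>R = p + (1 - \<alpha>) P R\<close>, where \<open>p\<close> is the current priority function. By the maximum principle,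
  \<open>p \<le> R \<le> max p / \<alpha>\<close>. Hence a popped node \<open>w\<close> has \<open>p w = max p \<ge> \<alpha> R w\<close>, and popping it
  multiplies \<open>R w\<close> by a factor of at most \<open>1 - \<alpha>\<close> and leaves the other values of \<open>R\<close> unchanged.
  Since \<open>R w \<ge> p w > \<alpha> \<epsilon>\<close> whenever \<open>w\<close> is popped and \<open>R w = \<pi>(w, v) \<le> 1\<close> initially, only nodes
  with \<open>\<pi>(w, v) > \<alpha> \<epsilon>\<close> are popped, each at most \<open>1 + ln (1 / (\<alpha> \<epsilon>)) / \<alpha>\<close> times.
\<close>

section \<open>Pending mass and the maximum principle\<close>

definition out_average :: "('a \<times> 'a) set \<Rightarrow> ('a \<Rightarrow> real) \<Rightarrow> 'a \<Rightarrow> real" where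
  "out_average E f u = (\<Sum>w\<in>out_nbrs E u. f w) / real (card (out_nbrs E u))"

text \<open>Phrased as a balance equation between the priorities and \<open>R\<close>, so that no
  record of the earlier pops is needed. Nonnegativity of \<open>p\<close> is included because it
  forces \<open>R\<close> to be nonnegative.\<close>

definition pending_mass ::
  "'a set \<Rightarrow> ('a \<times> 'a) set \<Rightarrow> real \<Rightarrow> ('a \<Rightarrow> real) \<Rightarrow> ('a \<Rightarrow> real) \<Rightarrow> bool" where
  "pending_mass V E \<alpha> p R \<longleftrightarrow>
     (\<forall>u\<in>V. 0 \<le> p u \<and> R u = p u + (1 - \<alpha>) * out_average E R u)"

lemma out_nbrs_subset: "digraph_no_dead_ends V E \<Longrightarrow> out_nbrs E u \<subseteq> V"
  by (auto simp: digraph_no_dead_ends_def out_nbrs_def)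

lemma finite_out_nbrs: "digraph_no_dead_ends V E \<Longrightarrow> finite (out_nbrs E u)"
  by (meson digraph_no_dead_ends_def finite_subset out_nbrs_subset)

lemma card_out_nbrs_pos: "digraph_no_dead_ends V E \<Longrightarrow> u \<in> V \<Longrightarrow> card (out_nbrs E u) > 0"
  by (meson card_gt_0_iff digraph_no_dead_ends_def finite_out_nbrs)

lemma out_average_le:
  assumes "digraph_no_dead_ends V E" "u \<in> V" "\<And>w. w \<in> V \<Longrightarrow> f w \<le> b"
  shows "out_average E f u \<le> b"
proof -
  have "(\<Sum>w\<in>out_nbrs E u. f w) \<le> real (card (out_nbrs E u)) * b"
    using sum_bounded_above[of "out_nbrs E u" f b] out_nbrs_subset[OF assms(1), of u] assms(3)
    by auto
  then show ?thesis
    using card_out_nbrs_pos[OF assms(1,2)]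
    by (simp add: out_average_def divide_simps mult.commute)
qed

lemma out_average_ge:
  assumes "digraph_no_dead_ends V E" "u \<in> V" "\<And>w. w \<in> V \<Longrightarrow> b \<le> f w"
  shows "b \<le> out_average E f u"
  using out_average_le[OF assms(1,2), of "\<lambda>w. - f w" "- b"] assms(3)
  by (simp add: out_average_def sum_negf)

text \<open>Up to the factor \<open>1 - \<alpha>\<close>, the loss of the average at
  \<open>u\<close> when \<open>f\<close> drops by \<open>d\<close> at \<open>w\<close> is the
  increase that \<open>u\<close> receives when \<open>w\<close> is popped with priority
  \<open>d\<close>.\<close>

lemma out_average_fun_upd:
  assumes "finite (out_nbrs E u)"
  shows "out_average E (f(w := f w - d)) u =
           out_average E f u - (if w \<in> out_nbrs E u then d / real (card (out_nbrs E u)) else 0)"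
proof -
  have "(\<Sum>x\<in>out_nbrs E u. (f(w := f w - d)) x) =
          (\<Sum>x\<in>out_nbrs E u. f x - (if x = w then d else 0))"
    by (intro sum.cong) auto
  also have "\<dots> = (\<Sum>x\<in>out_nbrs E u. f x) - (if w \<in> out_nbrs E u then d else 0)"
    using assms by (simp add: sum_subtractf)
  finally show ?thesis
    by (simp add: out_average_def diff_divide_distrib)
qed

text \<open>Maximum principle: where \<open>R\<close> attains its maximum \<open>b\<close> over
  \<open>V\<close>, the average of \<open>R\<close> is at most \<open>b\<close>, so
  \<open>b \<le> m + (1 - \<alpha>) * b\<close>.\<close>

lemma pending_mass_le:
  assumes G: "digraph_no_dead_ends V E" and \<alpha>: "0 < \<alpha>" "\<alpha> < 1"
    and R: "pending_mass V E \<alpha> p R" and p: "\<And>u. u \<in> V \<Longrightarrow> p u \<le> m" and w: "w \<in> V"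
  shows "\<alpha> * R w \<le> m"
proof -
  have fin: "finite V"
    using G by (simp add: digraph_no_dead_ends_def)
  define b where "b = Max (R ` V)"
  have le: "R u \<le> b" if "u \<in> V" for u
    using that fin by (simp add: b_def)
  have "b \<in> R ` V"
    unfolding b_def using fin w by (intro Max_in) auto
  then obtain u where u: "u \<in> V" "b = R u" by auto
  have "(1 - \<alpha>) * out_average E R u \<le> (1 - \<alpha>) * b"
    using out_average_le[OF G u(1) le] \<alpha> by (intro mult_left_mono) auto
  then have "\<alpha> * b \<le> m"
    using R[unfolded pending_mass_def, rule_format, OF u(1)] p[OF u(1)] u(2)
    by (simp add: left_diff_distrib)
  moreover have "\<alpha> * R w \<le> \<alpha> * b"
    using le[OF w] \<alpha> by simp
  ultimately show ?thesis by linarith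
qed

text \<open>Minimum principle: where \<open>R\<close> attains its minimum \<open>b\<close> over
  \<open>V\<close>, the equation and \<open>0 \<le> p\<close> give
  \<open>b \<ge> (1 - \<alpha>) * b\<close>.\<close>

lemma pending_mass_nonneg:
  assumes G: "digraph_no_dead_ends V E" and \<alpha>: "0 < \<alpha>" "\<alpha> < 1"
    and R: "pending_mass V E \<alpha> p R" and w: "w \<in> V"
  shows "0 \<le> R w"
proof -
  have fin: "finite V"
    using G by (simp add: digraph_no_dead_ends_def)
  define b where "b = Min (R ` V)"
  have ge: "b \<le> R u" if "u \<in> V" for u
    using that fin by (simp add: b_def)
  have "b \<in> R ` V"
    unfolding b_def using fin w by (intro Min_in) auto
  then obtain u where u: "u \<in> V" "b = R u" by auto
  have "(1 - \<alpha>) * b \<le> (1 - \<alpha>) * out_average E R u"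
    using out_average_ge[OF G u(1) ge] \<alpha> by (intro mult_left_mono) auto
  then have "0 \<le> \<alpha> * b"
    using R[unfolded pending_mass_def, rule_format, OF u(1)] u(2)
    by (simp add: left_diff_distrib)
  then show ?thesis
    using ge[OF w] \<alpha> by (simp add: zero_le_mult_iff)
qed

lemma pending_mass_ge:
  assumes G: "digraph_no_dead_ends V E" and \<alpha>: "0 < \<alpha>" "\<alpha> < 1"
    and R: "pending_mass V E \<alpha> p R" and w: "w \<in> V"
  shows "p w \<le> R w"
proof -
  have "0 \<le> (1 - \<alpha>) * out_average E R w"
    using out_average_ge[OF G w, of 0 R] pending_mass_nonneg[OF G \<alpha> R] \<alpha> by simp
  then show ?thesis
    using R w by (auto simp: pending_mass_def)
qed

section \<open>Pops as updates of the pending mass, with the resulting decay and termination\<close>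

lemma pending_mass_propagate:
  assumes G: "digraph_no_dead_ends V E" and \<alpha>: "0 < \<alpha>" "\<alpha> < 1"
    and R: "pending_mass V E \<alpha> (snd \<sigma>) R" and w: "w \<in> V"
  shows "pending_mass V E \<alpha> (snd (pq_propagate E \<alpha> w \<sigma>)) (R(w := R w - snd \<sigma> w))"
proof -
  obtain s p where \<sigma>: "\<sigma> = (s, p)" by (cases \<sigma>)
  define p' where "p' = snd (pq_propagate E \<alpha> w \<sigma>)"
  define inc where
    "inc u = (if w \<in> out_nbrs E u then p w / real (card (out_nbrs E u)) else 0)" for u
  have p': "p' u = (p(w := 0)) u + (1 - \<alpha>) * inc u" for u
    by (simp add: p'_def \<sigma> pq_propagate_def Let_def inc_def in_nbrs_def out_nbrs_def)
  \<comment> \<open>The gain \<open>(1 - \<alpha>) * inc u\<close> of the priority cancels the loss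
    of the averaged term. What remains is a drop by \<open>p w\<close> on both sides at
    \<open>u = w\<close>, with or without a self-loop.\<close>
  have "0 \<le> p' u \<and>
      (R(w := R w - p w)) u = p' u + (1 - \<alpha>) * out_average E (R(w := R w - p w)) u"
    if u: "u \<in> V" for u
  proof -
    have p: "0 \<le> p u" "0 \<le> p w" "R u = p u + (1 - \<alpha>) * out_average E R u"
      using R u w by (auto simp: pending_mass_def \<sigma>)
    have avg: "out_average E (R(w := R w - p w)) u = out_average E R u - inc u"
      by (simp add: out_average_fun_upd[OF finite_out_nbrs[OF G]] inc_def)
    have "0 \<le> (1 - \<alpha>) * inc u"
      using p \<alpha> by (simp add: inc_def)
    then show ?thesis
      unfolding avg p' using p by (auto simp: algebra_simps)
  qed
  then show ?thesis
    by (simp add: pending_mass_def p'_def \<sigma>)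
qed

text \<open>Two bounds on the same drop of \<open>R\<close> at \<open>w\<close>: the additive one
  drives termination, the multiplicative one limits how often a single node is popped.\<close>

lemma pq_step_pending_mass:
  assumes G: "digraph_no_dead_ends V E" and \<alpha>: "0 < \<alpha>" "\<alpha> < 1"
    and R: "pending_mass V E \<alpha> (snd \<sigma>) R" and step: "pq_step V E \<alpha> \<epsilon> \<sigma> w \<sigma>'"
  obtains R' where "pending_mass V E \<alpha> (snd \<sigma>') R'"
    and "R' w < R w - \<alpha> * \<epsilon>" "R' w \<le> (1 - \<alpha>) * R w" "\<And>u. u \<noteq> w \<Longrightarrow> R' u = R u"
    and "\<alpha> * \<epsilon> < R w"
proof
  have w: "w \<in> V" "\<And>u. u \<in> V \<Longrightarrow> snd \<sigma> u \<le> snd \<sigma> w" "\<alpha> * \<epsilon> < snd \<sigma> w"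
    and \<sigma>': "\<sigma>' = pq_propagate E \<alpha> w \<sigma>"
    using step by (auto simp: pq_step_def)
  show "pending_mass V E \<alpha> (snd \<sigma>') (R(w := R w - snd \<sigma> w))"
    unfolding \<sigma>' by (rule pending_mass_propagate[OF G \<alpha> R w(1)])
  show "(R(w := R w - snd \<sigma> w)) w < R w - \<alpha> * \<epsilon>"
    using w by simp
  \<comment> \<open>Since \<open>w\<close> has maximum priority, the maximum principle with
    \<open>m = snd \<sigma> w\<close> shows that the pop removes at least the fraction
    \<open>\<alpha>\<close> of \<open>R w\<close>.\<close>
  show "(R(w := R w - snd \<sigma> w)) w \<le> (1 - \<alpha>) * R w"
    using pending_mass_le[OF G \<alpha> R w(2,1)] by (simp add: algebra_simps)
  show "\<alpha> * \<epsilon> < R w"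
    using pending_mass_ge[OF G \<alpha> R w(1)] w(3) by simp
qed auto

text \<open>The exponent is one less than the number of pops of \<open>w\<close>: each pop before
  the last shrinks \<open>R w\<close> by the factor \<open>1 - \<alpha>\<close>, and at the last one
  \<open>R w\<close> still exceeds \<open>\<alpha> * \<epsilon>\<close>.\<close>

lemma pq_exec_count:
  assumes G: "digraph_no_dead_ends V E" and \<alpha>: "0 < \<alpha>" "\<alpha> < 1"
    and "pq_exec V E \<alpha> \<epsilon> \<sigma> ws \<sigma>'" and "pending_mass V E \<alpha> (snd \<sigma>) R"
    and "count_list ws w = Suc k"
  shows "w \<in> V \<and> \<alpha> * \<epsilon> < (1 - \<alpha>) ^ k * R w"
  using assms(4-)
proof (induction arbitrary: R k rule: pq_exec.induct)
  case (halt \<sigma>)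
  then show ?case by simp
next
  case (step \<sigma> x \<sigma>' ws \<sigma>'')
  obtain R' where R': "pending_mass V E \<alpha> (snd \<sigma>') R'" "R' x \<le> (1 - \<alpha>) * R x"
      "\<And>u. u \<noteq> x \<Longrightarrow> R' u = R u" "\<alpha> * \<epsilon> < R x"
    using pq_step_pending_mass[OF G \<alpha> step.prems(1) step.hyps(1)] by metis
  show ?case
  proof (cases "x = w")
    case False
    then have "count_list ws w = Suc k"
      using step.prems by simp
    then show ?thesis
      using step.IH[OF R'(1)] R'(3) False by metis
  next
    case True
    then have wV: "w \<in> V"
      using step.hyps(1) by (simp add: pq_step_def)
    have cnt: "count_list ws w = k"
      using step.prems True by simp
    show ?thesis
    proof (cases k)
      case 0
      then show ?thesis using R'(4) True wV by simp
    next
      case (Suc j)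
      \<comment> \<open>The rest of the run pops \<open>w\<close> another \<open>Suc j\<close>
        times; the present pop supplies the missing factor \<open>1 - \<alpha>\<close>.\<close>
      have "\<alpha> * \<epsilon> < (1 - \<alpha>) ^ j * R' w"
        using step.IH[OF R'(1)] cnt Suc by blast
      also have "\<dots> \<le> (1 - \<alpha>) ^ j * ((1 - \<alpha>) * R w)"
        using R'(2) True \<alpha> by (intro mult_left_mono) auto
      finally show ?thesis
        using wV Suc by (simp add: mult_ac)
    qed
  qed
qed

text \<open>Each step lowers the total of \<open>R\<close> over \<open>V\<close> by at least
  \<open>\<alpha> * \<epsilon> > 0\<close>, yet this total stays nonnegative.\<close>

lemma pq_not_diverges:
  assumes G: "digraph_no_dead_ends V E" and \<alpha>: "0 < \<alpha>" "\<alpha> < 1" and \<epsilon>: "0 < \<epsilon>"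
    and R: "pending_mass V E \<alpha> (snd \<sigma>) R"
  shows "\<not> pq_diverges V E \<alpha> \<epsilon> \<sigma>"
proof
  assume "pq_diverges V E \<alpha> \<epsilon> \<sigma>"
  then obtain \<tau> w where \<tau>: "\<tau> 0 = \<sigma>"
      and step: "\<And>i. pq_step V E \<alpha> \<epsilon> (\<tau> i) (w i) (\<tau> (Suc i))"
    by (auto simp: pq_diverges_def)
  have fin: "finite V"
    using G by (simp add: digraph_no_dead_ends_def)
  have "\<exists>R'. pending_mass V E \<alpha> (snd (\<tau> i)) R' \<and> sum R' V \<le> sum R V - real i * (\<alpha> * \<epsilon>)" for i
  proof (induction i)
    case 0
    then show ?case using R \<tau> by auto
  next
    case (Suc i)
    then obtain R1 where R1: "pending_mass V E \<alpha> (snd (\<tau> i)) R1"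
        "sum R1 V \<le> sum R V - real i * (\<alpha> * \<epsilon>)" by blast
    obtain R2 where R2: "pending_mass V E \<alpha> (snd (\<tau> (Suc i))) R2"
        "R2 (w i) < R1 (w i) - \<alpha> * \<epsilon>" "\<And>u. u \<noteq> w i \<Longrightarrow> R2 u = R1 u"
      using pq_step_pending_mass[OF G \<alpha> R1(1) step] by metis
    have wi: "w i \<in> V"
      using step by (simp add: pq_step_def)
    have "sum R2 (V - {w i}) = sum R1 (V - {w i})"
      using R2(3) by (intro sum.cong) auto
    then have "sum R2 V \<le> sum R1 V - \<alpha> * \<epsilon>"
      using sum.remove[OF fin wi, of R1] sum.remove[OF fin wi, of R2] R2(2) by simp
    then show ?case
      using R1(2) R2(1) by (intro exI[of _ R2]) (auto simp: algebra_simps)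
  qed
  then have "real i * (\<alpha> * \<epsilon>) \<le> sum R V" for i
    using sum_nonneg[of V] pending_mass_nonneg[OF G \<alpha>] by (smt (verit))
  moreover obtain i where "sum R V < real i * (\<alpha> * \<epsilon>)"
    using reals_Archimedean3[of "\<alpha> * \<epsilon>"] \<alpha> \<epsilon> by auto
  ultimately show False
    by (meson not_less)
qed

section \<open>Length and visits of the halting walk, and PageRank as the initial pending
  mass\<close>

lemma map_length_walk: "map_pmf length (walk E k u) = return_pmf (Suc k)"
proof (induction k arbitrary: u)
  case (Suc k)
  have "map_pmf length (map_pmf ((#) u) (walk E k w)) = return_pmf (Suc (Suc k))" for w
  proof -
    have "map_pmf length (map_pmf ((#) u) (walk E k w)) = map_pmf Suc (map_pmf length (walk E k w))"
      by (simp add: pmf.map_comp o_def)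
    then show ?thesis by (simp add: Suc.IH)
  qed
  then show ?case
    by (simp add: map_bind_pmf)
qed simp

lemma map_length_halting_walk:
  "map_pmf length (halting_walk E \<alpha> u) = map_pmf Suc (geometric_pmf \<alpha>)"
  by (simp add: halting_walk_def map_bind_pmf map_length_walk) (simp add: map_pmf_def)

text \<open>The starting node adds one to the geometric number of moves, so the mean is
  \<open>1 + (1 - \<alpha>) / \<alpha>\<close>. This is the denominator of
  \<open>ppr\<close>.\<close>

lemma
  assumes "0 < \<alpha>" "\<alpha> < 1"
  shows integrable_length_halting_walk:
      "integrable (halting_walk E \<alpha> u) (\<lambda>xs. real (length xs))"
    and expectation_length_halting_walk:
      "measure_pmf.expectation (halting_walk E \<alpha> u) (\<lambda>xs. real (length xs)) = 1 / \<alpha>"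
proof -
  have p: "\<alpha> \<in> {0<..1}" using assms by simp
  have int: "integrable (geometric_pmf \<alpha>) (\<lambda>k. 1 + real k)"
    using integrable_real_geometric_pmf[OF p] by simp
  have "integrable (map_pmf length (halting_walk E \<alpha> u)) real"
    using int by (simp add: map_length_halting_walk add.commute)
  then show "integrable (halting_walk E \<alpha> u) (\<lambda>xs. real (length xs))"
    by simp
  have "measure_pmf.expectation (halting_walk E \<alpha> u) (\<lambda>xs. real (length xs)) =
          measure_pmf.expectation (map_pmf length (halting_walk E \<alpha> u)) real"
    by simp
  also have "\<dots> = measure_pmf.expectation (geometric_pmf \<alpha>) (\<lambda>k. 1 + real k)"
    by (simp add: map_length_halting_walk add.commute)
  also have "\<dots> = 1 / \<alpha>"
    using integrable_real_geometric_pmf[OF p] expectation_geometric_pmf[OF p] assms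
    by (simp add: field_simps)
  finally show "measure_pmf.expectation (halting_walk E \<alpha> u) (\<lambda>xs. real (length xs)) = 1 / \<alpha>" .
qed

lemma count_list_le_length: "count_list xs x \<le> length xs"
  by (induction xs) auto

lemma integrable_count_halting_walk:
  assumes "0 < \<alpha>" "\<alpha> < 1"
  shows "integrable (halting_walk E \<alpha> u) (\<lambda>xs. real (count_list xs v))"
  by (rule Bochner_Integration.integrable_bound[OF integrable_length_halting_walk[OF assms]])
     (simp_all add: count_list_le_length)

text \<open>First-step analysis: the start is counted whether or not the walk halts there, and with
  probability \<open>1 - \<alpha>\<close> a fresh walk begins at a random out-neighbor. Nonnegative
  integrals allow unfolding the bind without integrability side conditions.\<close>

lemma expectation_count_halting_walk:
  fixes v :: 'a
  assumes G: "digraph_no_dead_ends V E" and \<alpha>: "0 < \<alpha>" "\<alpha> < 1" and u: "u \<in> V"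
  defines "h \<equiv> \<lambda>x. measure_pmf.expectation (halting_walk E \<alpha> x) (\<lambda>xs. real (count_list xs v))"
  shows "h u = (if u = v then 1 else 0) + (1 - \<alpha>) * out_average E h u"
proof -
  define d :: real where "d = (if u = v then 1 else 0)"
  have d: "d \<ge> 0" by (simp add: d_def)
  have h: "0 \<le> h x" for x
    by (simp add: h_def)
  \<comment> \<open>The shift \<open>c\<close> accounts for the possible visit at the start, which
    precedes the rest of the trajectory.\<close>
  have nn: "(\<integral>\<^sup>+ xs. ennreal (c + real (count_list xs v)) \<partial>halting_walk E \<alpha> x) = ennreal (c + h x)"
    if "c \<ge> 0" for c x
    using integrable_count_halting_walk[OF \<alpha>, of E x v] that
    by (subst nn_integral_eq_integral) (auto simp: h_def)
  have ne: "out_nbrs E u \<noteq> {}" and fin: "finite (out_nbrs E u)"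
    using G u finite_out_nbrs[OF G] by (auto simp: digraph_no_dead_ends_def)
  have avg: "measure_pmf.expectation (pmf_of_set (out_nbrs E u)) (\<lambda>w. d + h w) = d + out_average E h u"
    using card_out_nbrs_pos[OF G u]
    by (simp add: integral_pmf_of_set ne fin out_average_def sum.distrib field_simps)
  have nn_avg: "(\<integral>\<^sup>+ w. ennreal (d + h w) \<partial>pmf_of_set (out_nbrs E u)) = ennreal (d + out_average E h u)"
    using d h set_pmf_of_set[OF ne fin] fin
    by (subst nn_integral_eq_integral) (auto simp: avg intro!: integrable_measure_pmf_finite)
  have avg_nonneg: "0 \<le> out_average E h u"
    using out_average_ge[OF G u] h by blast
  have "ennreal (h u) = (\<integral>\<^sup>+ xs. ennreal (real (count_list xs v)) \<partial>halting_walk E \<alpha> u)"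
    using nn[of 0 u] by simp
  also have "\<dots> = (\<integral>\<^sup>+ halt. (if halt then ennreal d else
      (\<integral>\<^sup>+ w. \<integral>\<^sup>+ xs. ennreal (d + real (count_list xs v)) \<partial>halting_walk E \<alpha> w \<partial>pmf_of_set (out_nbrs E u)))
      \<partial>bernoulli_pmf \<alpha>)"
    unfolding halting_walk_unfold[OF \<alpha>(1) less_imp_le[OF \<alpha>(2)], of E u] nn_integral_bind_pmf
    by (intro nn_integral_cong) (auto simp: d_def add.commute)
  also have "\<dots> = ennreal d * ennreal \<alpha> + ennreal (d + out_average E h u) * ennreal (1 - \<alpha>)"
    using \<alpha> by (simp add: nn[OF d] nn_avg)
  also have "\<dots> = ennreal (d * \<alpha> + (d + out_average E h u) * (1 - \<alpha>))"
    using \<alpha> d avg_nonneg by (simp add: ennreal_mult ennreal_plus)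
  finally have "h u = d * \<alpha> + (d + out_average E h u) * (1 - \<alpha>)"
    using \<alpha> d avg_nonneg h[of u] by (subst (asm) ennreal_inj) auto
  then show ?thesis
    by (simp add: d_def algebra_simps)
qed

text \<open>As the mean length is \<open>1 / \<alpha>\<close>, PageRank is \<open>\<alpha>\<close>
  times the expected number of visits. Scaling the first-step equation by \<open>\<alpha>\<close>
  turns its indicator of \<open>v\<close> into the initial priorities.\<close>

lemma pending_mass_ppr:
  assumes G: "digraph_no_dead_ends V E" and \<alpha>: "0 < \<alpha>" "\<alpha> < 1"
  shows "pending_mass V E \<alpha> (snd (pq_init \<alpha> v)) (\<lambda>u. ppr E \<alpha> u v)"
proof -
  define h where "h x = measure_pmf.expectation (halting_walk E \<alpha> x) (\<lambda>xs. real (count_list xs v))" for x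
  have ppr: "ppr E \<alpha> u v = \<alpha> * h u" for u
    using \<alpha> by (simp add: ppr_def h_def expectation_length_halting_walk)
  have avg: "out_average E (\<lambda>u. \<alpha> * h u) u = \<alpha> * out_average E h u" for u
    by (simp add: out_average_def sum_distrib_left)
  have "h u = (if u = v then 1 else 0) + (1 - \<alpha>) * out_average E h u" if "u \<in> V" for u
    using expectation_count_halting_walk[OF G \<alpha> that, of v] unfolding h_def .
  from this[THEN arg_cong, of _ "(*) \<alpha>"] show ?thesis
    using \<alpha> unfolding pending_mass_def ppr avg
    by (auto simp: pq_init_def algebra_simps)
qed

section \<open>Pops per node and the running time\<close>

lemma sum_list_eq_sum_real_count:
  fixes f :: "'a \<Rightarrow> real"
  assumes "finite A" "set xs \<subseteq> A"
  shows "(\<Sum>x\<leftarrow>xs. f x) = (\<Sum>x\<in>A. real (count_list xs x) * f x)"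
  using assms(2)
proof (induction xs)
  case (Cons y xs)
  have "(\<Sum>x\<in>A. real (count_list (y # xs) x) * f x) =
          (\<Sum>x\<in>A. real (count_list xs x) * f x + (if x = y then f x else 0))"
    by (intro sum.cong) (auto simp: algebra_simps)
  then show ?case
    using Cons assms(1) by (simp add: sum.distrib)
qed simp

lemma pq_exec_count_le:
  assumes G: "digraph_no_dead_ends V E" and \<alpha>: "0 < \<alpha>" "\<alpha> < 1" and \<epsilon>: "0 < \<epsilon>"
    and exec: "pq_exec V E \<alpha> \<epsilon> (pq_init \<alpha> v) ws \<sigma>" and w: "w \<in> set ws"
  shows "w \<in> V" and "\<alpha> * \<epsilon> < ppr E \<alpha> w v"
    and "real (count_list ws w) \<le> 1 + ln (1 / (\<epsilon> * \<alpha>)) / \<alpha>"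
proof -
  have "count_list ws w \<noteq> 0"
    using w by (simp add: count_list_0_iff)
  then obtain k where k: "count_list ws w = Suc k"
    using not0_implies_Suc by blast
  note * = pq_exec_count[OF G \<alpha> exec pending_mass_ppr[OF G \<alpha>] k]
  show wV: "w \<in> V" using * by blast
  have nonneg: "0 \<le> ppr E \<alpha> w v"
    using pending_mass_nonneg[OF G \<alpha> pending_mass_ppr[OF G \<alpha>] wV] .
  \<comment> \<open>The initial priorities are at most \<open>\<alpha>\<close>, so the maximum
    principle applies with \<open>m = \<alpha>\<close>.\<close>
  have "\<alpha> * ppr E \<alpha> w v \<le> \<alpha>"
    using pending_mass_le[OF G \<alpha> pending_mass_ppr[OF G \<alpha>] _ wV, of v \<alpha>] \<alpha>
    by (simp add: pq_init_def)
  then have le1: "ppr E \<alpha> w v \<le> 1"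
    using \<alpha> by simp
  have "(1 - \<alpha>) ^ k * ppr E \<alpha> w v \<le> 1 * ppr E \<alpha> w v"
    using \<alpha> nonneg by (intro mult_right_mono power_le_one) auto
  then show "\<alpha> * \<epsilon> < ppr E \<alpha> w v"
    using * by simp
  have "(1 - \<alpha>) ^ k * ppr E \<alpha> w v \<le> (1 - \<alpha>) ^ k * 1"
    using \<alpha> le1 by (intro mult_left_mono) auto
  then have "\<alpha> * \<epsilon> < (1 - \<alpha>) ^ k"
    using * by simp
  then have "ln (\<alpha> * \<epsilon>) < ln ((1 - \<alpha>) ^ k)"
    using \<alpha> \<epsilon> by simp
  also have "\<dots> = real k * ln (1 - \<alpha>)"
    using \<alpha> by (simp add: ln_realpow)
  \<comment> \<open>The estimate \<open>ln (1 - \<alpha>) \<le> - \<alpha>\<close> is the source of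
    the factor \<open>1 / \<alpha>\<close> in the bound.\<close>
  also have "\<dots> \<le> real k * (- \<alpha>)"
    using ln_add_one_self_le_self2[of "- \<alpha>"] \<alpha> by (intro mult_left_mono) auto
  finally have "real k * \<alpha> \<le> ln (1 / (\<epsilon> * \<alpha>))"
    using \<alpha> \<epsilon> by (simp add: ln_div mult.commute)
  then show "real (count_list ws w) \<le> 1 + ln (1 / (\<epsilon> * \<alpha>)) / \<alpha>"
    using k \<alpha> by (simp add: field_simps)
qed

text \<open>One \<open>C\<close> serves all graphs and parameters. The bound
  \<open>x\<^sub>0\<close> keeps \<open>\<alpha> * \<epsilon>\<close> away from 1, where the
  logarithm tends to 0 although \<open>v\<close> is still popped whenever
  \<open>\<epsilon> < 1\<close>.\<close>

theorem theorem3: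
  fixes c_pop c_inc x\<^sub>0 :: real
  assumes "c_pop \<ge> 0" and "c_inc \<ge> 0" and "x\<^sub>0 < 1"
  shows "\<exists>C. \<forall>(V :: 'a set) E \<alpha> v \<epsilon>.
           digraph_no_dead_ends V E \<and> 0 < \<alpha> \<and> \<alpha> < 1 \<and> v \<in> V \<and> 0 < \<epsilon> \<and> \<alpha> * \<epsilon> \<le> x\<^sub>0 \<longrightarrow>
             \<not> pq_diverges V E \<alpha> \<epsilon> (pq_init \<alpha> v) \<and>
             (\<forall>ws \<sigma>. pq_exec V E \<alpha> \<epsilon> (pq_init \<alpha> v) ws \<sigma> \<longrightarrow>
                pq_time V E c_pop c_inc ws
                  \<le> C * (D_target V E \<alpha> v (\<alpha> * \<epsilon>) / \<alpha> * ln (1 / (\<epsilon> * \<alpha>))))"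
proof (intro exI allI impI conjI)
  fix V :: "'a set" and E \<alpha> v \<epsilon>
  assume *: "digraph_no_dead_ends V E \<and> 0 < \<alpha> \<and> \<alpha> < 1 \<and> v \<in> V \<and> 0 < \<epsilon> \<and> \<alpha> * \<epsilon> \<le> x\<^sub>0"
  then have G: "digraph_no_dead_ends V E" and \<alpha>: "0 < \<alpha>" "\<alpha> < 1" and v: "v \<in> V"
    and \<epsilon>: "0 < \<epsilon>" and x\<^sub>0: "\<alpha> * \<epsilon> \<le> x\<^sub>0"
    by auto
  show "\<not> pq_diverges V E \<alpha> \<epsilon> (pq_init \<alpha> v)"
    by (rule pq_not_diverges[OF G \<alpha> \<epsilon> pending_mass_ppr[OF G \<alpha>]])
  fix ws \<sigma>
  assume exec: "pq_exec V E \<alpha> \<epsilon> (pq_init \<alpha> v) ws \<sigma>"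
  note popped = pq_exec_count_le[OF G \<alpha> \<epsilon> exec]
  define n where "n = real (card V)"
  define c where "c = c_pop + c_inc"
  define L where "L = ln (1 / (\<epsilon> * \<alpha>))"
  \<comment> \<open>\<open>K\<close> absorbs the summand 1 of the pop count:
    \<open>L \<ge> ln (1 / x\<^sub>0) > 0\<close> and \<open>\<alpha> < 1\<close> give
    \<open>1 \<le> (L / \<alpha>) / ln (1 / x\<^sub>0)\<close>.\<close>
  define K where "K = 1 + 1 / ln (1 / x\<^sub>0)"
  define S where "S = {u \<in> V. \<alpha> * \<epsilon> < ppr E \<alpha> u v}"
  define cost where "cost u = real (card (in_nbrs E u)) + ln n" for u
  have fin: "finite V"
    using G by (simp add: digraph_no_dead_ends_def)
  have n: "0 \<le> ln n"
    using v fin by (cases "card V") (auto simp: n_def)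
  have cost: "0 \<le> cost u" for u
    using n by (simp add: cost_def)
  have c: "0 \<le> c"
    using assms by (simp add: c_def)
  have \<alpha>\<epsilon>: "0 < \<alpha> * \<epsilon>"
    using \<alpha> \<epsilon> by simp
  have x\<^sub>0_pos: "0 < ln (1 / x\<^sub>0)"
    using \<alpha>\<epsilon> x\<^sub>0 assms(3) by (intro ln_gt_zero) auto
  have L: "ln (1 / x\<^sub>0) \<le> L"
    unfolding L_def using \<alpha>\<epsilon> x\<^sub>0
    by (subst ln_le_cancel_iff) (auto simp: mult.commute intro!: divide_left_mono mult_pos_pos)
  have "1 \<le> L / ln (1 / x\<^sub>0)"
    using x\<^sub>0_pos L by simp
  also have "\<dots> \<le> L / ln (1 / x\<^sub>0) / \<alpha>"
    using \<alpha> L x\<^sub>0_pos by (simp add: le_divide_eq mult_left_le)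
  finally have count: "1 + L / \<alpha> \<le> K * (L / \<alpha>)"
    by (simp add: K_def distrib_left distrib_right add_divide_distrib mult.commute)
  have "pq_time V E c_pop c_inc ws \<le> (\<Sum>w\<leftarrow>ws. c * cost w)"
    unfolding pq_time_def
  proof (rule sum_list_mono)
    fix w
    show "c_pop * ln (real (card V)) + c_inc * real (card (in_nbrs E w)) \<le> c * cost w"
      using assms n by (simp add: c_def cost_def n_def algebra_simps)
  qed
  also have "\<dots> = (\<Sum>w\<in>set ws. real (count_list ws w) * (c * cost w))"
    by (rule sum_list_eq_sum_real_count) auto
  also have "\<dots> \<le> (\<Sum>w\<in>set ws. K * (L / \<alpha>) * (c * cost w))"
    using popped(3) count c cost
    by (intro sum_mono mult_right_mono) (auto simp: L_def intro: order_trans)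
  \<comment> \<open>All popped nodes lie in \<open>S\<close>, and the added terms are nonnegative
    because \<open>v \<in> V\<close> gives \<open>ln n \<ge> 0\<close>.\<close>
  also have "\<dots> \<le> (\<Sum>w\<in>S. K * (L / \<alpha>) * (c * cost w))"
    using popped(1,2) fin c cost \<alpha> L x\<^sub>0_pos
    by (intro sum_mono2) (auto simp: S_def K_def)
  also have "\<dots> = c * K * (D_target V E \<alpha> v (\<alpha> * \<epsilon>) / \<alpha> * L)"
    by (simp add: D_target_def S_def cost_def n_def sum_distrib_left sum_divide_distrib
        sum_distrib_right mult_ac)
  finally show "pq_time V E c_pop c_inc ws \<le>
      (c_pop + c_inc) * (1 + 1 / ln (1 / x\<^sub>0)) *
      (D_target V E \<alpha> v (\<alpha> * \<epsilon>) / \<alpha> * ln (1 / (\<epsilon> * \<alpha>)))"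
    by (simp add: c_def K_def L_def)
qed

end
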